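(* For $n\ge 2$, the line graph $L(K_n)$ of the complete graph $K_n$ satisfies $\mathrm{gp}^-(L(K_n))=\frac{n}{2}$ if $n$ is even and $\mathrm{gp}^-(L(K_n))=\frac{n+3}{2}$ if $n$ is odd.
   Context: A set $S$ of vertices of a connected graph $G$ is a general position set if no shortest path contains three or more vertices of $S$; it is maximal if not properly contained in another general position set; $\mathrm{gp}^-(G)$ is the number of vertices in a smallest maximal general position set. *)

theory Defs
  imports Complex_Main
begin

record 'a ugraph =
  verts :: "'a set"
  edges :: "'a set set"

definition complete_graph :: "nat \<Rightarrow> nat ugraph" where
  "complete_graph n =
     \<lparr>verts = {..<n}, edges = {{u, v} | u v. u < n \<and> v < n \<and> u \<noteq> v}\<rparr>"

definition line_graph :: "'a ugraph \<Rightarrow> 'a set ugraph" where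
  "line_graph G =
     \<lparr>verts = edges G,
      edges = {{e, f} | e f. e \<in> edges G \<and> f \<in> edges G \<and> e \<noteq> f \<and> e \<inter> f \<noteq> {}}\<rparr>"

text \<open>A path is given by the list of its vertices; its number of edges is one less than
  the length of that list.\<close>

definition is_path :: "'a ugraph \<Rightarrow> 'a list \<Rightarrow> bool" where
  "is_path G p \<longleftrightarrow> p \<noteq> [] \<and> distinct p \<and> set p \<subseteq> verts G \<and>
     (\<forall>i. Suc i < length p \<longrightarrow> {p ! i, p ! Suc i} \<in> edges G)"

definition shortest_path :: "'a ugraph \<Rightarrow> 'a list \<Rightarrow> bool" where
  "shortest_path G p \<longleftrightarrow> is_path G p \<and>
     (\<forall>q. is_path G q \<and> hd q = hd p \<and> last q = last p \<longrightarrow> length p \<le> length q)"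

definition general_position_set :: "'a ugraph \<Rightarrow> 'a set \<Rightarrow> bool" where
  "general_position_set G S \<longleftrightarrow> S \<subseteq> verts G \<and>
     \<not> (\<exists>p. shortest_path G p \<and> card (set p \<inter> S) \<ge> 3)"

definition maximal_general_position_set :: "'a ugraph \<Rightarrow> 'a set \<Rightarrow> bool" where
  "maximal_general_position_set G S \<longleftrightarrow> general_position_set G S \<and>
     \<not> (\<exists>T. general_position_set G T \<and> S \<subset> T)"

text \<open>Meaningful for finite graphs, which always have a maximal general position set.\<close>

definition gp_minus :: "'a ugraph \<Rightarrow> nat" where
  "gp_minus G = (LEAST k. \<exists>S. maximal_general_position_set G S \<and> finite S \<and> card S = k)"

end

theory Submission
  imports Defs
begin

text \<open>Two edges of \<open>K\<^sub>n\<close> have distance at most 2 in \<open>L(K\<^sub>n)\<close>, so three edges lie on a common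
  shortest path iff they form a path with three edges in \<open>K\<^sub>n\<close>. Hence \<open>gp\<^sup>-(L(K\<^sub>n))\<close> is the
  saturation number of the path \<open>P\<^sub>4\<close> on four vertices. A perfect matching, or a triangle together
  with a perfect matching of the other vertices, attains the claimed value. For the lower bound, an
  isolated vertex of a saturated graph forces all other degrees to be at least 2; if no vertex is
  isolated, then the degree sum is at least \<open>n\<close>, and for odd \<open>n\<close> the degree sum \<open>n + 1\<close> would mean
  that some component is a path with two edges, which can be closed to a triangle.\<close>

section \<open>Edge sets saturated with respect to the path on four vertices\<close>

definition P4_free :: "'a set set \<Rightarrow> bool" where
  "P4_free S \<longleftrightarrow> \<not> (\<exists>a b c d. distinct [a, b, c, d] \<and> {a, b} \<in> S \<and> {b, c} \<in> S \<and> {c, d} \<in> S)"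

text \<open>Only extensions by a single edge are tested. This captures maximality under inclusion
  because \<open>P4_free\<close> passes to subsets.\<close>

definition P4_saturated :: "nat \<Rightarrow> nat set set \<Rightarrow> bool" where
  "P4_saturated n S \<longleftrightarrow> S \<subseteq> edges (complete_graph n) \<and> P4_free S \<and>
     (\<forall>u<n. \<forall>v<n. u \<noteq> v \<longrightarrow> {u, v} \<notin> S \<longrightarrow> \<not> P4_free (insert {u, v} S))"

lemma P4_free_mono: "P4_free T \<Longrightarrow> S \<subseteq> T \<Longrightarrow> P4_free S"
  unfolding P4_free_def by blast

text \<open>A path with three edges that appears after the insertion must use the new edge, either
  as an end edge, traversed in one of two directions, or as the middle edge. A path having it as its
  last edge is read backwards.\<close>

lemma P4_free_insertD:
  assumes "P4_free S" "\<not> P4_free (insert {u, v} S)"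
  obtains x y where "distinct [u, v, x, y]" "{v, x} \<in> S" "{x, y} \<in> S"
    | x y where "distinct [v, u, x, y]" "{u, x} \<in> S" "{x, y} \<in> S"
    | x y where "distinct [x, u, v, y]" "{u, x} \<in> S" "{v, y} \<in> S"
proof -
  obtain a b c d where d: "distinct [a, b, c, d]" and
    e: "{a, b} \<in> insert {u, v} S" "{b, c} \<in> insert {u, v} S" "{c, d} \<in> insert {u, v} S"
    using assms(2) unfolding P4_free_def not_not by (elim exE conjE) (rule that)
  have "\<not> ({a, b} \<in> S \<and> {b, c} \<in> S \<and> {c, d} \<in> S)"
    using assms(1) d unfolding P4_free_def by metis
  then consider "{a, b} = {u, v}" | "{b, c} = {u, v}" | "{c, d} = {u, v}"
    using e by (metis insertE)
  then show thesis
  proof cases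
    case 1
    then have "{b, c} \<in> S" "{c, d} \<in> S"
      using d e by (auto simp: doubleton_eq_iff)
    then show thesis using 1 d that(1)[of c d] that(2)[of c d]
      by (auto simp: doubleton_eq_iff)
  next
    case 2
    then have "{b, a} \<in> S" "{c, d} \<in> S"
      using d e by (auto simp: doubleton_eq_iff insert_commute)
    then show thesis using 2 d that(3)[of a d] that(3)[of d a]
      by (auto simp: doubleton_eq_iff)
  next
    case 3
    then have "{c, b} \<in> S" "{b, a} \<in> S"
      using d e by (auto simp: doubleton_eq_iff insert_commute)
    then show thesis using 3 d that(1)[of b a] that(2)[of b a]
      by (auto simp: doubleton_eq_iff)
  qed
qed

section \<open>Shortest paths and general position in the line graph of a complete graph\<close>

lemma mem_edges_complete_graph:
  "{u, v} \<in> edges (complete_graph n) \<longleftrightarrow> u < n \<and> v < n \<and> u \<noteq> v"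
  by (auto simp: complete_graph_def doubleton_eq_iff)

lemma edges_complete_graphE:
  assumes "e \<in> edges (complete_graph n)"
  obtains u v where "e = {u, v}" "u < n" "v < n" "u \<noteq> v"
  using assms by (auto simp: complete_graph_def)

lemma finite_edges_complete_graph: "finite (edges (complete_graph n))"
  by (rule finite_subset[of _ "Pow {..<n}"]) (auto simp: complete_graph_def)

lemma verts_line_graph: "verts (line_graph G) = edges G"
  by (simp add: line_graph_def)

lemma mem_edges_line_graph:
  "{e, f} \<in> edges (line_graph G) \<longleftrightarrow> e \<in> edges G \<and> f \<in> edges G \<and> e \<noteq> f \<and> e \<inter> f \<noteq> {}"
  by (auto simp: line_graph_def doubleton_eq_iff)

lemma is_path_pair: "is_path G [e, f] \<longleftrightarrow> e \<noteq> f \<and> e \<in> verts G \<and> f \<in> verts G \<and> {e, f} \<in> edges G"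
  by (auto simp: is_path_def less_Suc_eq)

lemma is_path_triple: "is_path G [e, f, g] \<longleftrightarrow> distinct [e, f, g] \<and>
    e \<in> verts G \<and> f \<in> verts G \<and> g \<in> verts G \<and> {e, f} \<in> edges G \<and> {f, g} \<in> edges G"
  by (auto simp: is_path_def less_Suc_eq nth_Cons')

text \<open>The two end edges are disjoint, hence distinct and nonadjacent in the line graph, so no
  path with one or two vertices joins them.\<close>

lemma shortest_path_line_graph_of_P4:
  assumes "distinct [a, b, c, d]" "{a, b} \<in> edges G" "{b, c} \<in> edges G" "{c, d} \<in> edges G"
  shows "shortest_path (line_graph G) [{a, b}, {b, c}, {c, d}]"
  unfolding shortest_path_def
proof (intro conjI allI impI)
  show "is_path (line_graph G) [{a, b}, {b, c}, {c, d}]"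
    using assms by (auto simp: is_path_triple verts_line_graph mem_edges_line_graph doubleton_eq_iff)
  fix q assume q: "is_path (line_graph G) q \<and> hd q = hd [{a, b}, {b, c}, {c, d}] \<and>
      last q = last [{a, b}, {b, c}, {c, d}]"
  show "length [{a, b}, {b, c}, {c, d}] \<le> length q"
  proof (rule ccontr)
    assume "\<not> ?thesis"
    moreover have "q \<noteq> []" using q by (auto simp: is_path_def)
    ultimately consider e where "q = [e]" | e f where "q = [e, f]"
      by (cases q; cases "tl q") (auto simp: Suc_le_eq)
    then show False
      using q assms(1) by cases (auto simp: is_path_pair mem_edges_line_graph doubleton_eq_iff)
  qed
qed

text \<open>If the ends of \<open>p\<close> met, they would be adjacent and \<open>p\<close> too
  long. Disjoint ends are joined through a single further edge, so \<open>p\<close> has exactly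
  three vertices.\<close>

lemma shortest_path_line_graph_complete:
  assumes p: "shortest_path (line_graph (complete_graph n)) p" and len: "3 \<le> length p"
  obtains a b c d where "distinct [a, b, c, d]" "p = [{a, b}, {b, c}, {c, d}]"
proof -
  let ?G = "complete_graph n" and ?L = "line_graph (complete_graph n)"
  have path: "is_path ?L p" using p by (simp add: shortest_path_def)
  have min: "length p \<le> length q" if "is_path ?L q" "hd q = hd p" "last q = last p" for q
    using p that by (simp add: shortest_path_def)
  have ne: "p \<noteq> []" and sub: "set p \<subseteq> edges ?G"
    using path by (auto simp: is_path_def verts_line_graph)
  let ?e = "hd p" and ?g = "last p"
  have eg: "?e \<in> edges ?G" "?g \<in> edges ?G" using ne sub by auto
  have "?e \<noteq> ?g"
    using path len by (cases p) (auto simp: is_path_def split: if_splits)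
  have disj: "?e \<inter> ?g = {}"
  proof (rule ccontr)
    assume "?e \<inter> ?g \<noteq> {}"
    then have "is_path ?L [?e, ?g]"
      using eg \<open>?e \<noteq> ?g\<close> by (simp add: is_path_pair verts_line_graph mem_edges_line_graph)
    from min[OF this] len show False by simp
  qed
  obtain a b where ab: "?e = {a, b}" "a < n" "b < n" "a \<noteq> b"
    using eg by (auto elim: edges_complete_graphE)
  obtain c d where cd: "?g = {c, d}" "c < n" "d < n" "c \<noteq> d"
    using eg by (auto elim: edges_complete_graphE)
  \<comment> \<open>Completeness enters here: \<open>{b, c}\<close> is an edge, which bounds the
    distance of the two ends by 2.\<close>
  have "is_path ?L [{a, b}, {b, c}, {c, d}]"
    using ab cd disj
    by (auto simp: is_path_triple verts_line_graph mem_edges_line_graph doubleton_eq_iff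
        mem_edges_complete_graph)
  from min[OF this] ab cd len have "length p = 3" by simp
  then obtain f where pf: "p = [?e, f, ?g]"
    by (auto simp: numeral_3_eq_3 length_Suc_conv)
  then have f: "f \<in> edges ?G" "?e \<inter> f \<noteq> {}" "f \<inter> ?g \<noteq> {}"
    using path by (metis is_path_triple mem_edges_line_graph)+
  obtain x y where xy: "f = {x, y}" "x \<noteq> y"
    using f(1) by (auto elim: edges_complete_graphE)
  \<comment> \<open>The middle edge meets both ends, which are disjoint, so it has one endpoint in
    each. The endpoints are renamed accordingly.\<close>
  obtain b' c' where bc: "b' \<in> ?e" "c' \<in> ?g" "f = {b', c'}"
    using f xy disj by blast
  obtain a' where "?e = {a', b'}" "a' \<noteq> b'" using ab bc by auto
  moreover obtain d' where "?g = {c', d'}" "c' \<noteq> d'" using cd bc by auto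
  ultimately show thesis using that[of a' b' c' d'] pf bc disj by auto
qed

lemma general_position_set_line_graph_complete:
  "general_position_set (line_graph (complete_graph n)) S \<longleftrightarrow>
     S \<subseteq> edges (complete_graph n) \<and> P4_free S"
proof (intro iffI conjI)
  assume gp: "general_position_set (line_graph (complete_graph n)) S"
  then show sub: "S \<subseteq> edges (complete_graph n)"
    by (simp add: general_position_set_def verts_line_graph)
  show "P4_free S"
    unfolding P4_free_def
  proof clarify
    fix a b c d
    assume d: "distinct [a, b, c, d]" and e: "{a, b} \<in> S" "{b, c} \<in> S" "{c, d} \<in> S"
    let ?p = "[{a, b}, {b, c}, {c, d}]"
    have "shortest_path (line_graph (complete_graph n)) ?p"
      using shortest_path_line_graph_of_P4[OF d] e sub by blast
    moreover have "set ?p \<inter> S = set ?p" using e by auto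
    moreover have "card (set ?p) = 3"
      using d by (subst distinct_card) (auto simp: doubleton_eq_iff)
    ultimately have "shortest_path (line_graph (complete_graph n)) ?p \<and> 3 \<le> card (set ?p \<inter> S)"
      by (metis order_refl)
    then show False using gp unfolding general_position_set_def by blast
  qed
next
  assume S: "S \<subseteq> edges (complete_graph n) \<and> P4_free S"
  have False if p: "shortest_path (line_graph (complete_graph n)) p" and "3 \<le> card (set p \<inter> S)"
    for p
  proof -
    have "3 \<le> length p"
      using that(2) card_mono[of "set p" "set p \<inter> S"] card_length[of p] by simp
    from p this obtain a b c d where d: "distinct [a, b, c, d]" "p = [{a, b}, {b, c}, {c, d}]"
      by (rule shortest_path_line_graph_complete)
    \<comment> \<open>Since \<open>p\<close> has just three vertices, three of them in
      \<open>S\<close> means all of them.\<close>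
    have "card (set p) \<le> 3" using card_length[of p] d by simp
    then have "set p \<inter> S = set p" by (intro card_seteq) (use that(2) in auto)
    then have "set p \<subseteq> S" by (metis Int_lower2)
    then have "{a, b} \<in> S" "{b, c} \<in> S" "{c, d} \<in> S" unfolding d(2) by simp_all
    with S d(1) show False unfolding P4_free_def by metis
  qed
  then show "general_position_set (line_graph (complete_graph n)) S"
    using S by (auto simp: general_position_set_def verts_line_graph)
qed

lemma maximal_general_position_set_line_graph_complete:
  "maximal_general_position_set (line_graph (complete_graph n)) S \<longleftrightarrow> P4_saturated n S"
proof
  assume S: "maximal_general_position_set (line_graph (complete_graph n)) S"
  show "P4_saturated n S"
    unfolding P4_saturated_def
  proof (intro conjI allI impI)
    show sub: "S \<subseteq> edges (complete_graph n)" and "P4_free S"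
      using S by (auto simp: maximal_general_position_set_def general_position_set_line_graph_complete)
    fix u v assume uv: "u < n" "v < n" "u \<noteq> v" "{u, v} \<notin> S"
    then have "insert {u, v} S \<subseteq> edges (complete_graph n)"
      using sub mem_edges_complete_graph by auto
    then show "\<not> P4_free (insert {u, v} S)"
      using S uv(4) unfolding maximal_general_position_set_def
        general_position_set_line_graph_complete by blast
  qed
next
  assume S: "P4_saturated n S"
  have False if T: "T \<subseteq> edges (complete_graph n)" "P4_free T" "S \<subset> T" for T
  proof -
    obtain e where e: "e \<in> T" "e \<notin> S" using T by blast
    then obtain u v where "e = {u, v}" "u < n" "v < n" "u \<noteq> v"
      using T by (meson edges_complete_graphE subsetD)
    moreover have "P4_free (insert e S)" using T e by (intro P4_free_mono[OF T(2)]) auto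
    ultimately show False using S e by (auto simp: P4_saturated_def)
  qed
  then show "maximal_general_position_set (line_graph (complete_graph n)) S"
    using S unfolding maximal_general_position_set_def general_position_set_line_graph_complete
      P4_saturated_def by blast
qed

section \<open>Lower bound by vertex degrees, where the degree of \<open>v\<close> in
  \<open>S\<close> is \<open>card {e \<in> S. v \<in> e}\<close>\<close>

lemma handshake_complete_graph:
  assumes "S \<subseteq> edges (complete_graph n)"
  shows "(\<Sum>v<n. card {e \<in> S. v \<in> e}) = 2 * card S"
proof (rule sum_multicount)
  show "finite S" using assms finite_edges_complete_graph by (rule finite_subset)
  show "\<forall>e\<in>S. card {v \<in> {..<n}. v \<in> e} = 2"
  proof
    fix e assume "e \<in> S"
    then obtain u v where "e = {u, v}" "u < n" "v < n" "u \<noteq> v"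
      using assms by (meson edges_complete_graphE subsetD)
    moreover from this have "{w \<in> {..<n}. w \<in> e} = {u, v}" by auto
    ultimately show "card {w \<in> {..<n}. w \<in> e} = 2" by simp
  qed
qed simp

lemma incident_edgeE:
  assumes "S \<subseteq> edges (complete_graph n)" "e \<in> S" "v \<in> e"
  obtains w where "e = {v, w}" "w < n" "v < n" "w \<noteq> v"
proof -
  obtain x y where "e = {x, y}" "x < n" "y < n" "x \<noteq> y"
    using assms by (meson edges_complete_graphE subsetD)
  then show thesis using that[of x] that[of y] assms(3) by auto
qed

lemma degree_one_unique:
  assumes "card {e \<in> S. v \<in> e} = 1" "{v, x} \<in> S" "{v, y} \<in> S"
  shows "x = y"
proof -
  obtain e where e: "{e \<in> S. v \<in> e} = {e}" using assms(1) by (rule card_1_singletonE)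
  have "{v, x} \<in> {e \<in> S. v \<in> e}" "{v, y} \<in> {e \<in> S. v \<in> e}" using assms(2,3) by simp_all
  then have "{v, x} = {v, y}" unfolding e by simp
  then show ?thesis by (auto simp: doubleton_eq_iff)
qed

text \<open>If \<open>w\<close> had degree 0, joining it to the isolated \<open>v\<close> would
  create an isolated edge. If \<open>w\<close> had \<open>u\<close> as its only neighbour, joining
  \<open>v\<close> to \<open>u\<close> would create a path from \<open>v\<close> through
  \<open>u\<close>, and replacing \<open>v\<close> by \<open>w\<close> would give such a path
  already in \<open>S\<close>.\<close>

lemma P4_saturated_isolated:
  assumes S: "P4_saturated n S" and v: "v < n" "\<And>x. {v, x} \<notin> S"
    and w: "w < n" "w \<noteq> v"
  shows "2 \<le> card {e \<in> S. w \<in> e}"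
proof (rule ccontr)
  assume "\<not> ?thesis"
  then consider "card {e \<in> S. w \<in> e} = 0" | "card {e \<in> S. w \<in> e} = 1" by linarith
  moreover have sub: "S \<subseteq> edges (complete_graph n)" and free: "P4_free S"
    and sat: "\<And>x. x < n \<Longrightarrow> x \<noteq> v \<Longrightarrow> \<not> P4_free (insert {v, x} S)"
    using S v by (auto simp: P4_saturated_def)
  moreover have fin: "finite S"
    using sub finite_edges_complete_graph by (rule finite_subset)
  ultimately show False
  proof cases
    case 1
    then have "{w, x} \<notin> S" for x using fin by auto
    with v(2) show False
      by (rule_tac P4_free_insertD[OF free sat[OF w]]) auto
  next
    case 2
    then obtain e where "{e \<in> S. w \<in> e} = {e}" by (rule card_1_singletonE)
    then have "e \<in> S" "w \<in> e" by auto
    then obtain u where u: "{w, u} \<in> S" "u < n" "u \<noteq> w"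
      using sub by (metis incident_edgeE)
    have "u \<noteq> v" using u(1) v(2)[of w] by (auto simp: insert_commute)
    \<comment> \<open>The other two shapes of the new path use an edge of \<open>S\<close> at
      \<open>v\<close>, and there is none.\<close>
    then obtain x y where xy: "distinct [v, u, x, y]" "{u, x} \<in> S" "{x, y} \<in> S"
      using v(2) by (rule_tac P4_free_insertD[OF free sat[OF u(2)]]) auto
    \<comment> \<open>If \<open>w\<close> were \<open>x\<close> or \<open>y\<close>, it would have a
      neighbour other than \<open>u\<close>.\<close>
    have "x \<noteq> w" using degree_one_unique[OF 2 u(1), of y] xy by auto
    moreover have "y \<noteq> w"
      using degree_one_unique[OF 2 u(1), of x] xy by (auto simp: insert_commute)
    ultimately have "distinct [w, u, x, y]" using xy u by auto
    with free xy(2,3) u(1) show False unfolding P4_free_def by metis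
  qed
qed

text \<open>Degree sum \<open>n + 1\<close> leaves one vertex \<open>v\<close> of degree 2 and
  degree 1 elsewhere. Then \<open>v\<close> and its neighbours \<open>a\<close>, \<open>b\<close>
  form a component, and adding \<open>{a, b}\<close> only turns it into a triangle, against
  saturation.\<close>

lemma P4_saturated_degree_sum:
  assumes S: "P4_saturated n S" and pos: "\<And>v. v < n \<Longrightarrow> 1 \<le> card {e \<in> S. v \<in> e}"
  shows "(\<Sum>v<n. card {e \<in> S. v \<in> e}) \<noteq> n + 1"
proof
  let ?d = "\<lambda>v. card {e \<in> S. v \<in> e}"
  assume sum: "(\<Sum>v<n. ?d v) = n + 1"
  have sub: "S \<subseteq> edges (complete_graph n)" and free: "P4_free S"
    using S by (auto simp: P4_saturated_def)
  \<comment> \<open>All degrees are positive, so the truncated subtraction is exact and the total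
    excess over 1 is 1.\<close>
  have "(\<Sum>v<n. ?d v - 1) = (\<Sum>v<n. ?d v) - (\<Sum>v<n. 1)"
    using pos by (intro sum_subtractf_nat) auto
  then have "(\<Sum>v<n. ?d v - 1) = 1" using sum by simp
  then obtain v where v: "v < n" "?d v - 1 = 1" and one: "\<And>w. w < n \<Longrightarrow> w \<noteq> v \<Longrightarrow> ?d w - 1 = 0"
    by (subst (asm) sum_eq_1_iff) auto
  have "?d v = 2" using v(2) by simp
  then obtain e f where ef: "{e \<in> S. v \<in> e} = {e, f}" "e \<noteq> f" by (auto simp: card_2_iff)
  then have "e \<in> S" "v \<in> e" "f \<in> S" "v \<in> f" by auto
  then obtain a b where a: "e = {v, a}" "a < n" "a \<noteq> v" and b: "f = {v, b}" "b < n" "b \<noteq> v"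
    using sub by (metis incident_edgeE)
  have va: "{a, v} \<in> S" and vb: "{b, v} \<in> S"
    using a b \<open>e \<in> S\<close> \<open>f \<in> S\<close> by (auto simp: insert_commute)
  have "a \<noteq> b" using ef a b by auto
  have da: "?d a = 1" and db: "?d b = 1" using one[of a] one[of b] pos[of a] pos[of b] a b by auto
  have ax: "x = v" if "{a, x} \<in> S" for x using degree_one_unique[OF da that va] .
  have bx: "x = v" if "{b, x} \<in> S" for x using degree_one_unique[OF db that vb] .
  have vx: "x = a \<or> x = b" if "{v, x} \<in> S" for x
  proof -
    have "{v, x} \<in> {e \<in> S. v \<in> e}" using that by simp
    then show ?thesis unfolding ef using a(1) b(1) by (auto simp: doubleton_eq_iff)
  qed
  have "{a, b} \<notin> S" using ax b by blast
  then have "\<not> P4_free (insert {a, b} S)" using S a b \<open>a \<noteq> b\<close> by (auto simp: P4_saturated_def)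
  \<comment> \<open>Each shape of the new path needs an edge of \<open>S\<close> from
    \<open>a\<close>, \<open>b\<close> or \<open>v\<close> to a fourth vertex.\<close>
  with free show False
  proof (rule P4_free_insertD)
    fix x y assume "distinct [a, b, x, y]" "{b, x} \<in> S" "{x, y} \<in> S"
    then show False using bx[of x] vx[of y] by auto
  next
    fix x y assume "distinct [b, a, x, y]" "{a, x} \<in> S" "{x, y} \<in> S"
    then show False using ax[of x] vx[of y] by auto
  next
    fix x y assume "distinct [x, a, b, y]" "{a, x} \<in> S" "{b, y} \<in> S"
    then show False using ax[of x] bx[of y] by auto
  qed
qed

text \<open>With an isolated vertex the degree sum is at least \<open>2 * (n - 1)\<close>, which
  suffices except for \<open>n = 3\<close>. Without one it is at least \<open>n\<close>, and parity
  together with the excluded value \<open>n + 1\<close> gives the odd case.\<close>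

lemma P4_saturated_card_ge:
  assumes S: "P4_saturated n S" and n: "n \<ge> 2"
  shows "if even n then n \<le> 2 * card S else n + 3 \<le> 2 * card S"
proof -
  let ?d = "\<lambda>v. card {e \<in> S. v \<in> e}"
  have sub: "S \<subseteq> edges (complete_graph n)" using S by (simp add: P4_saturated_def)
  have fin: "finite S" using sub finite_edges_complete_graph by (rule finite_subset)
  have hs: "(\<Sum>v<n. ?d v) = 2 * card S" by (rule handshake_complete_graph[OF sub])
  show ?thesis
  proof (cases "\<exists>v<n. ?d v = 0")
    case True
    then obtain v where v: "v < n" "?d v = 0" by blast
    have iso: "{v, x} \<notin> S" for x using v fin by auto
    have two: "2 \<le> ?d w" if "w < n" "w \<noteq> v" for w
      using P4_saturated_isolated[OF S v(1) iso that] .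
    have "(\<Sum>w\<in>{..<n} - {v}. 2) \<le> (\<Sum>w\<in>{..<n} - {v}. ?d w)"
      using two by (intro sum_mono) auto
    moreover have "(\<Sum>w<n. ?d w) = ?d v + (\<Sum>w\<in>{..<n} - {v}. ?d w)"
      using v by (intro sum.remove) auto
    ultimately have le: "n - 1 \<le> card S" using hs v by simp
    \<comment> \<open>For \<open>n = 3\<close> the set \<open>S\<close> would need degree 2 at a
      vertex \<open>w\<close> other than \<open>v\<close>, but with \<open>v\<close> isolated only
      one edge can contain \<open>w\<close>.\<close>
    have "n \<noteq> 3"
    proof
      assume n3: "n = 3"
      define w where "w = (if v = 0 then 1 else 0 :: nat)"
      have w: "w < n" "w \<noteq> v" by (auto simp: w_def n3)
      have "e = {0, 1, 2} - {v}" if "e \<in> S" "w \<in> e" for e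
      proof -
        obtain x where x: "e = {w, x}" "x < n" "x \<noteq> w" using incident_edgeE[OF sub \<open>e \<in> S\<close> \<open>w \<in> e\<close>] .
        have "x \<noteq> v" using iso[of w] x that by (auto simp: insert_commute)
        then show ?thesis using x w v n3 by (auto simp: less_Suc_eq numeral_3_eq_3)
      qed
      then have "{e \<in> S. w \<in> e} \<subseteq> {{0, 1, 2} - {v}}" by blast
      from card_mono[OF _ this] two[OF w] show False by simp
    qed
    then show ?thesis using le n by (auto elim!: oddE)
  next
    case False
    then have pos: "1 \<le> ?d v" if "v < n" for v using that by (simp add: Suc_le_eq)
    have "(\<Sum>v<n. 1) \<le> (\<Sum>v<n. ?d v)" using pos by (intro sum_mono) auto
    moreover have "(\<Sum>v<n. ?d v) \<noteq> n + 1" by (rule P4_saturated_degree_sum[OF S pos])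
    ultimately have "n \<le> 2 * card S" "2 * card S \<noteq> n + 1" using hs by simp_all
    \<comment> \<open>For odd \<open>n\<close> the even number \<open>2 * card S\<close> is at least
      \<open>n + 1\<close> and differs from it, so it is at least \<open>n + 3\<close>.\<close>
    then show ?thesis by presburger
  qed
qed

section \<open>Upper bound by disjoint unions of small cliques\<close>

text \<open>This is the disjoint union of the complete graphs on the fibres of \<open>f\<close> in
  \<open>{..<n}\<close>, so that a matching or a triangle is described by a labelling.\<close>

definition cluster_edges :: "nat \<Rightarrow> (nat \<Rightarrow> 'b) \<Rightarrow> nat set set" where
  "cluster_edges n f = {{x, y} | x y. x < n \<and> y < n \<and> x \<noteq> y \<and> f x = f y}"

lemma mem_cluster_edges: "{x, y} \<in> cluster_edges n f \<longleftrightarrow> x < n \<and> y < n \<and> x \<noteq> y \<and> f x = f y"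
  by (auto simp: cluster_edges_def doubleton_eq_iff)

lemma cluster_edgesE:
  assumes "e \<in> cluster_edges n f"
  obtains x y where "e = {x, y}" "x < y" "y < n" "f x = f y"
proof -
  obtain x y where "e = {x, y}" "x < n" "y < n" "x \<noteq> y" "f x = f y"
    using assms by (auto simp: cluster_edges_def)
  then show thesis using that[of x y] that[of y x] by (auto simp: neq_iff insert_commute)
qed

text \<open>A path stays inside one fibre, and fibres are too small for four vertices. A new edge
  joins two fibres, and a partner of each endpoint in its own fibre extends it to a path with three
  edges.\<close>

lemma P4_saturated_cluster_edges:
  assumes le3: "\<And>a b c d. distinct [a, b, c, d] \<Longrightarrow> f a = f b \<Longrightarrow> f b = f c \<Longrightarrow> f c = f d \<Longrightarrow> False"
    and ge2: "\<And>x. x < n \<Longrightarrow> \<exists>y<n. y \<noteq> x \<and> f y = f x"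
  shows "P4_saturated n (cluster_edges n f)"
  unfolding P4_saturated_def
proof (intro conjI allI impI)
  show "cluster_edges n f \<subseteq> edges (complete_graph n)"
    by (auto simp: cluster_edges_def complete_graph_def)
  show "P4_free (cluster_edges n f)"
    using le3 unfolding P4_free_def mem_cluster_edges by blast
  fix u v assume uv: "u < n" "v < n" "u \<noteq> v" "{u, v} \<notin> cluster_edges n f"
  then have "f u \<noteq> f v" by (simp add: mem_cluster_edges)
  moreover obtain x y where "x < n" "x \<noteq> u" "f x = f u" "y < n" "y \<noteq> v" "f y = f v"
    using ge2 uv by metis
  ultimately have "distinct [x, u, v, y]" "{x, u} \<in> cluster_edges n f" "{v, y} \<in> cluster_edges n f"
    using uv by (auto simp: mem_cluster_edges)
  then show "\<not> P4_free (insert {u, v} (cluster_edges n f))"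
    unfolding P4_free_def by blast
qed

text \<open>The witness is the perfect matching of \<open>2 * i\<close> with
  \<open>2 * i + 1\<close>. Bounding its size from above is enough, as the lower bound holds for all
  saturated sets.\<close>

lemma ex_P4_saturated_even:
  assumes "even n"
  shows "\<exists>S. P4_saturated n S \<and> 2 * card S \<le> n"
proof (intro exI conjI)
  let ?f = "\<lambda>x::nat. x div 2"
  show "P4_saturated n (cluster_edges n ?f)"
  proof (rule P4_saturated_cluster_edges)
    fix x assume "x < n"
    then have "(if even x then x + 1 else x - 1) < n" using assms by (auto elim!: evenE)
    then show "\<exists>y<n. y \<noteq> x \<and> y div 2 = x div 2" by (auto elim!: evenE oddE split: if_splits)
  qed auto
  have "cluster_edges n ?f \<subseteq> (\<lambda>i. {2 * i, 2 * i + 1}) ` {..<n div 2}"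
  proof
    fix e assume "e \<in> cluster_edges n ?f"
    then obtain x y where e: "e = {x, y}" "x < y" "y < n" "x div 2 = y div 2"
      by (rule cluster_edgesE)
    define i where "i = x div 2"
    have "x = 2 * i" "y = 2 * i + 1" "i < n div 2"
      using e(2-4) unfolding i_def by linarith+
    then show "e \<in> (\<lambda>i. {2 * i, 2 * i + 1}) ` {..<n div 2}" using e(1) by blast
  qed
  then have "card (cluster_edges n ?f) \<le> n div 2" using surj_card_le[of "{..<n div 2}"] by simp
  then show "2 * card (cluster_edges n ?f) \<le> n" by linarith
qed

lemma ex_P4_saturated_odd:
  assumes "odd n" "n \<ge> 2"
  shows "\<exists>S. P4_saturated n S \<and> 2 * card S \<le> n + 3"
proof (intro exI conjI)
  \<comment> \<open>Truncated subtraction puts 0 into the same cluster as 1 and 2.\<close>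
  let ?f = "\<lambda>x::nat. (x - 1) div 2"
  show "P4_saturated n (cluster_edges n ?f)"
  proof (rule P4_saturated_cluster_edges)
    fix x assume "x < n"
    define k where "k = (x - 1) div 2"
    have "x = 0 \<or> x = 2 * k + 1 \<or> x = 2 * k + 2" unfolding k_def by linarith
    then consider "x = 0" | "x = 2 * k + 1" | "x = 2 * k + 2" by blast
    then show "\<exists>y<n. y \<noteq> x \<and> ?f y = ?f x"
    proof cases
      case 1
      then show ?thesis using assms(2) by (intro exI[of _ 1]) simp
    next
      case 2
      \<comment> \<open>Oddness of \<open>n\<close> excludes \<open>n = 2 * k + 2\<close>, so the
        partner is in range.\<close>
      then have "2 * k + 2 < n" using \<open>x < n\<close> assms(1) by (auto elim!: oddE)
      then show ?thesis using 2 by (intro exI[of _ "2 * k + 2"]) simp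
    next
      case 3
      then show ?thesis using \<open>x < n\<close> by (intro exI[of _ "2 * k + 1"]) simp
    qed
  next
    fix a b c d :: nat
    assume "distinct [a, b, c, d]" and eq: "?f a = ?f b" "?f b = ?f c" "?f c = ?f d"
    \<comment> \<open>A value \<open>t\<close> of \<open>?f\<close> is taken only at
      \<open>2 * t + 1\<close>, \<open>2 * t + 2\<close> and, when \<open>t = 0\<close>, also at 0,
      hence at most three times.\<close>
    have *: "x = 2 * ?f x + 1 \<or> x = 2 * ?f x + 2 \<or> x = 0 \<and> ?f x = 0" for x :: nat
      by (cases x) auto
    have "b = 2 * ?f a + 1 \<or> b = 2 * ?f a + 2 \<or> b = 0 \<and> ?f a = 0"
      "c = 2 * ?f a + 1 \<or> c = 2 * ?f a + 2 \<or> c = 0 \<and> ?f a = 0"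
      "d = 2 * ?f a + 1 \<or> d = 2 * ?f a + 2 \<or> d = 0 \<and> ?f a = 0"
      using *[of b] *[of c] *[of d] eq by metis+
    with *[of a] \<open>distinct [a, b, c, d]\<close> show False
      by (metis distinct_length_2_or_more)
  qed
  let ?g = "\<lambda>i::nat. {2 * i + 1, 2 * i + 2}"
  \<comment> \<open>The triangle consists of \<open>?g 0\<close> and the two edges at 0, so the
    bound is \<open>2 + n div 2\<close>, which is half of \<open>n + 3\<close> for odd
    \<open>n\<close>.\<close>
  let ?A = "{{0, 1}, {0, 2}} \<union> ?g ` {..<n div 2}"
  have "cluster_edges n ?f \<subseteq> ?A"
  proof
    fix e assume "e \<in> cluster_edges n ?f"
    then obtain x y where e: "e = {x, y}" "x < y" "y < n" "(x - 1) div 2 = (y - 1) div 2"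
      by (rule cluster_edgesE)
    show "e \<in> ?A"
    proof (cases "x = 0")
      case True
      then have "y = 1 \<or> y = 2" using e(2,4) by auto
      then show ?thesis using e True by auto
    next
      case False
      define i where "i = (x - 1) div 2"
      have "x = 2 * i + 1" "y = 2 * i + 2" "i < n div 2"
        using e(2-4) False unfolding i_def by linarith+
      then show ?thesis using e(1) by blast
    qed
  qed
  then have "card (cluster_edges n ?f) \<le> card ?A" by (intro card_mono) auto
  also have "\<dots> \<le> 2 + n div 2"
    using card_Un_le[of "{{0, 1}, {0, 2::nat}}" "?g ` {..<n div 2}"] card_image_le[of "{..<n div 2}" ?g]
      card_insert_le_m1[of 2 "{{0, 2::nat}}" "{0, 1}"] by simp
  finally show "2 * card (cluster_edges n ?f) \<le> n + 3" using assms(1) by (auto elim!: oddE)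
qed

lemma gp_minus_eqI:
  assumes "maximal_general_position_set G S" "finite S" "card S = k"
    and "\<And>T. maximal_general_position_set G T \<Longrightarrow> finite T \<Longrightarrow> k \<le> card T"
  shows "gp_minus G = k"
  unfolding gp_minus_def by (rule Least_equality) (use assms in auto)

theorem theorem5p2:
  fixes n :: nat
  assumes "n \<ge> 2"
  shows "(even n \<longrightarrow> real (gp_minus (line_graph (complete_graph n))) = real n / 2) \<and>
         (odd n \<longrightarrow> real (gp_minus (line_graph (complete_graph n))) = (real n + 3) / 2)"
proof -
  let ?m = "if even n then n else n + 3"
  obtain S where S: "P4_saturated n S" "2 * card S \<le> ?m"
    using ex_P4_saturated_even ex_P4_saturated_odd assms by (cases "even n") auto
  have ge: "?m \<le> 2 * card T" if "P4_saturated n T" for T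
    using P4_saturated_card_ge[OF that assms] by (simp split: if_splits)
  have "finite S"
    using S finite_edges_complete_graph by (auto simp: P4_saturated_def intro: finite_subset)
  moreover have "card S \<le> card T" if "P4_saturated n T" for T
    using ge[OF that] S(2) by linarith
  ultimately have "gp_minus (line_graph (complete_graph n)) = card S"
    using S(1) by (intro gp_minus_eqI) (auto simp: maximal_general_position_set_line_graph_complete)
  \<comment> \<open>Applying the lower bound to the constructed set itself turns its size estimate
    into an equality.\<close>
  moreover have "2 * card S = ?m" using ge[OF S(1)] S(2) by simp
  then have "real (2 * card S) = real ?m" by (rule arg_cong)
  ultimately show ?thesis by (simp add: mult.commute)
qed

end
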